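(* Let $H=H(b,\delta,\lambda)$ be a balanced HST and let $W$ be a random $n$-element submultiset of its leaves. Then \[\mathbf{E}[M(W)]\le B_{b,\lambda}\sum_{k=1}^{\delta}(b\lambda)^k\] for some positive constant $B_{b,\lambda}$ depending only on $b$ and $\lambda$. If moreover $n\ge b^{\delta}$, then \[\mathbf{E}[M(W)]\ge A_{b,\lambda}\sum_{k=1}^{\delta}(b\lambda)^k\] for some positive constant $A_{b,\lambda}$ depending only on $b$ and $\lambda$.
   Context: A balanced HST $H(b,\delta,\lambda)$ (integers $b\ge2$, $\delta\ge1$, real $0<\lambda<1$) is a rooted tree in which every non-leaf vertex has exactly $b$ children and every leaf is at depth $\delta$; the root is at level $0$, and each edge joining a vertex at level $\ell-1$ to a child at level $\ell$ has weight $\lambda^\ell$. The distance $d_H(x,y)$ is the total weight of the tree path between $x$ and $y$. A random $n$-element submultiset of the leaves is obtained by choosing $n$ leaves independently and uniformly at random (repetitions allowed); copies of the same leaf are treated as distinct points at distance $0$. For a finite multiset $V$ of leaves, $M(V)$ is the minimum of $\sum d_H(x,y)$ over all perfect matchings of the complete graph on $V$; if $|V|$ is odd, $M(V)$ is the minimum of $M(V\setminus\{x\})$ over $x\in V$.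
   Formalization: The lower bound is stated except when b=2, δ=1 and n is odd: there exactly one leaf carries an odd number of points, so removing one of them leaves a matching of cost 0, M(W)=0 always, and no positive lower bound holds. *)

theory Defs
  imports "HOL-Probability.Probability" "HOL-Library.Disjoint_Sets"
begin

text \<open>
  The balanced HST with parameters \<open>b\<close>, \<open>\<delta>\<close>, \<open>lam\<close>: a vertex is the word over
  \<open>{..<b}\<close> recording the choice of child at every step from the root \<open>[]\<close>, so the level of a
  vertex is the length of the word.
\<close>

definition hst_vertices :: "nat \<Rightarrow> nat \<Rightarrow> nat list set" where
  "hst_vertices b \<delta> = {v. length v \<le> \<delta> \<and> set v \<subseteq> {..<b}}"

definition hst_leaves :: "nat \<Rightarrow> nat \<Rightarrow> nat list set" where
  "hst_leaves b \<delta> = {v \<in> hst_vertices b \<delta>. length v = \<delta>}"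

definition hst_child :: "nat list \<Rightarrow> nat list \<Rightarrow> bool" where
  "hst_child u v \<longleftrightarrow> (\<exists>a. v = u @ [a])"

definition hst_adj :: "nat list \<Rightarrow> nat list \<Rightarrow> bool" where
  "hst_adj u v \<longleftrightarrow> hst_child u v \<or> hst_child v u"

definition hst_path :: "nat \<Rightarrow> nat \<Rightarrow> nat list \<Rightarrow> nat list \<Rightarrow> nat list list \<Rightarrow> bool" where
  "hst_path b \<delta> x y p \<longleftrightarrow>
     p \<noteq> [] \<and> hd p = x \<and> last p = y \<and> distinct p \<and> set p \<subseteq> hst_vertices b \<delta> \<and> successively hst_adj p"

text \<open>The level of the lower endpoint of an edge is the maximum of the two levels.\<close>

definition hst_edge_weight :: "real \<Rightarrow> nat list \<Rightarrow> nat list \<Rightarrow> real" where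
  "hst_edge_weight lam u v = lam ^ max (length u) (length v)"

definition hst_path_weight :: "real \<Rightarrow> nat list list \<Rightarrow> real" where
  "hst_path_weight lam p = (\<Sum>(u, v)\<leftarrow>zip p (tl p). hst_edge_weight lam u v)"

definition hst_dist :: "nat \<Rightarrow> nat \<Rightarrow> real \<Rightarrow> nat list \<Rightarrow> nat list \<Rightarrow> real" where
  "hst_dist b \<delta> lam x y = hst_path_weight lam (THE p. hst_path b \<delta> x y p)"

text \<open>
  A finite multiset of points is given as a family \<open>X\<close> indexed by a finite set \<open>I\<close> of
  naturals; distinct indices are distinct points even when \<open>X\<close> takes the same value on them.
  A perfect matching of the complete graph on \<open>I\<close> is a partition of \<open>I\<close> into
  two-element sets.
\<close>

definition perfect_matchings :: "nat set \<Rightarrow> nat set set set" where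
  "perfect_matchings I = {P. partition_on I P \<and> (\<forall>e\<in>P. card e = 2)}"

definition matching_cost :: "('a \<Rightarrow> 'a \<Rightarrow> real) \<Rightarrow> (nat \<Rightarrow> 'a) \<Rightarrow> nat set set \<Rightarrow> real" where
  "matching_cost d X P = (\<Sum>(i, j) | i < j \<and> {i, j} \<in> P. d (X i) (X j))"

definition min_perfect_matching :: "('a \<Rightarrow> 'a \<Rightarrow> real) \<Rightarrow> nat set \<Rightarrow> (nat \<Rightarrow> 'a) \<Rightarrow> real" where
  "min_perfect_matching d I X = Min (matching_cost d X ` perfect_matchings I)"

definition min_matching :: "('a \<Rightarrow> 'a \<Rightarrow> real) \<Rightarrow> nat set \<Rightarrow> (nat \<Rightarrow> 'a) \<Rightarrow> real" where
  "min_matching d I X =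
     (if even (card I) then min_perfect_matching d I X
      else Min ((\<lambda>i. min_perfect_matching d (I - {i}) X) ` I))"

text \<open>The indices \<open>{..<n}\<close> are mapped to independent uniform leaves.\<close>

definition random_leaves :: "nat \<Rightarrow> nat \<Rightarrow> nat \<Rightarrow> (nat \<Rightarrow> nat list) pmf" where
  "random_leaves b \<delta> n = Pi_pmf {..<n} [] (\<lambda>_. pmf_of_set (hst_leaves b \<delta>))"

definition expected_matching :: "nat \<Rightarrow> nat \<Rightarrow> real \<Rightarrow> nat \<Rightarrow> real" where
  "expected_matching b \<delta> lam n =
     measure_pmf.expectation (random_leaves b \<delta> n) (min_matching (hst_dist b \<delta> lam) {..<n})"

text \<open>
  The case \<open>b = 2\<close>, \<open>\<delta> = 1\<close>, \<open>n\<close> odd is degenerate: exactly one of the two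
  leaves carries an odd number of points, and discarding one of those leaves a perfect matching of
  cost \<open>0\<close>. No positive lower bound can hold there; the case \<open>n = 3\<close> is recorded below.
\<close>

lemma hst_dist_self:
  assumes "x \<in> hst_vertices b \<delta>"
  shows "hst_dist b \<delta> lam x x = 0"
proof -
  have "(THE p. hst_path b \<delta> x x p) = [x]"
  proof (rule the_equality)
    show "hst_path b \<delta> x x [x]" using assms by (simp add: hst_path_def)
    fix p assume "hst_path b \<delta> x x p"
    then show "p = [x]"
      by (cases p) (auto simp: hst_path_def split: if_splits)
  qed
  then show ?thesis by (simp add: hst_dist_def hst_path_weight_def)
qed

lemma hst_dist_nonneg: "0 \<le> lam \<Longrightarrow> 0 \<le> hst_dist b \<delta> lam x y"
  unfolding hst_dist_def hst_path_weight_def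
  by (rule sum_list_nonneg) (auto simp: hst_edge_weight_def)

lemma perfect_matchings_pair:
  assumes "i \<noteq> j"
  shows "perfect_matchings {i, j} = {{{i, j}}}"
proof -
  have "P = {{i, j}}" if P: "partition_on {i, j} P" "\<forall>e\<in>P. card e = 2" for P
  proof -
    have "e = {i, j}" if "e \<in> P" for e
      using P that assms by (intro card_subset_eq) (auto simp: partition_on_def)
    moreover have "P \<noteq> {}" using P by (auto simp: partition_on_def)
    ultimately show ?thesis by blast
  qed
  moreover have "partition_on {i, j} {{i, j}}" "card {i, j} = 2"
    using assms by (auto intro: partition_on_space)
  ultimately show ?thesis unfolding perfect_matchings_def by blast
qed

lemma expected_matching_degenerate:
  assumes "0 < lam"
  shows "expected_matching 2 1 lam 3 = 0"
proof -
  let ?d = "hst_dist 2 1 lam"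
  have leaves: "hst_leaves 2 1 = {[0], [1]}"
    by (auto simp: hst_leaves_def hst_vertices_def length_Suc_conv less_2_cases_iff)
  have pair: "min_perfect_matching ?d {i, j} X = ?d (X i) (X j)" if "i < j" for i j X
  proof -
    have "{(k, l). k < l \<and> {k, l} = {i, j}} = {(i, j)}"
      using that by (auto simp: doubleton_eq_iff)
    then show ?thesis using that
      by (simp add: min_perfect_matching_def perfect_matchings_pair matching_cost_def)
  qed
  have "min_matching ?d {..<3} X = 0" if X: "X \<in> set_pmf (random_leaves 2 1 3)" for X
  proof -
    have XL: "X i = [0] \<or> X i = [1]" if "i < 3" for i
    proof -
      have "X i \<in> hst_leaves 2 1"
        using X that set_pmf_of_set[of "hst_leaves 2 1"] leaves
        by (simp add: random_leaves_def set_Pi_pmf PiE_dflt_def)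
      then show ?thesis unfolding leaves by blast
    qed
    have I: "{..<3::nat} = {0, 1, 2}" by auto
    have D: "{0::nat, 1, 2} - {0} = {1, 2}" "{0::nat, 1, 2} - {1} = {0, 2}"
      "{0::nat, 1, 2} - {2} = {0, 1}" by auto
    have M: "min_matching ?d {..<3} X =
        Min {?d (X 1) (X 2), ?d (X 0) (X 2), ?d (X 0) (X 1)}"
    proof -
      have "odd (card {0::nat, 1, 2})" by simp
      then have "min_matching ?d {0, 1, 2} X =
          Min ((\<lambda>i. min_perfect_matching ?d ({0, 1, 2} - {i}) X) ` {0, 1, 2})"
        unfolding min_matching_def by (rule if_not_P)
      then show ?thesis
        unfolding I image_insert image_empty D
        using pair[of 1 2 X] pair[of 0 2 X] pair[of 0 1 X] by simp
    qed
    have z: "?d [0] [0] = 0" "?d [1] [1] = 0"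
      by (auto intro!: hst_dist_self simp: hst_vertices_def)
    have "X 0 = X 1 \<or> X 0 = X 2 \<or> X 1 = X 2"
      using XL[of 0] XL[of 1] XL[of 2] by auto
    then have "?d (X 1) (X 2) = 0 \<or> ?d (X 0) (X 2) = 0 \<or> ?d (X 0) (X 1) = 0"
      using XL[of 0] XL[of 1] XL[of 2] z by auto
    then show ?thesis
      unfolding M using hst_dist_nonneg[of lam 2 1] assms by (intro Min_eqI) auto
  qed
  then show ?thesis unfolding expected_matching_def
    by (intro integral_eq_zero_AE) (simp add: AE_measure_pmf_iff)
qed

end

theory Submission
  imports Defs "HOL-Library.Sublist"
begin

text \<open>
  The distance of two leaves is the sum of \<open>2 * lam ^ k\<close> over the levels \<open>k\<close>
  at which their ancestors differ.

  Upper bound, valid pointwise: among \<open>m\<close> points, two share their ancestor at every level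
  \<open>k\<close> with \<open>b ^ k < m\<close>. Matching such a pair and repeating, level \<open>k\<close> is charged
  only while at most \<open>b ^ k\<close> points remain, hence at most \<open>lam ^ k * b ^ k\<close> in total.

  Lower bound: a matching costs at least \<open>lam ^ k\<close> for every level-\<open>k\<close> vertex with an odd
  number of points below it. The parity of a count is a product of signs, so by independence such a
  vertex is odd with probability \<open>(1 - (1 - 2 / b ^ k) ^ n) / 2 \<ge> 3 / 8\<close>. If \<open>n\<close> is odd, the
  discarded point costs at most one odd vertex per level, which is affordable as soon as
  \<open>b ^ k \<ge> 3\<close>; the only level lost is \<open>k = 1\<close> for \<open>b = 2\<close>, and its term is dominated
  by that of level 2.
\<close>

subsection \<open>Distances between leaves\<close>

lemma hst_adj_enter_subtree:
  assumes "hst_adj u v" "\<not> prefix x u" "prefix x v"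
  shows "v = x"
  using assms by (auto simp: hst_adj_def hst_child_def prefix_snoc)

text \<open>The only edge into the subtree below \<open>x\<close> from outside leads to
  \<open>x\<close> itself, so a walk that avoids \<open>x\<close> can never enter.\<close>

lemma path_stays_outside_subtree:
  assumes "successively hst_adj p" "p \<noteq> []" "\<not> prefix x (hd p)" "x \<notin> set p"
  shows "\<not> prefix x (last p)"
  using assms
proof (induction p)
  case (Cons u p)
  show ?case
  proof (cases "p = []")
    case False
    then have "hst_adj u (hd p)" "x \<noteq> hd p"
      using Cons.prems by (auto simp: successively_Cons)
    then have "\<not> prefix x (hd p)"
      using hst_adj_enter_subtree Cons.prems(3) by fastforce
    then show ?thesis
      using Cons False by (simp add: successively_Cons)
  qed (use Cons.prems in simp)
qed simp

text \<open>The counterpart for leaving: the subtree below a child of \<open>x\<close> is joined to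
  the rest only through \<open>x\<close>.\<close>

lemma hst_adj_leave_subtree:
  assumes "hst_adj u v" "prefix (x @ [a]) u" "\<not> prefix (x @ [a]) v"
  shows "v = x"
  using assms by (auto simp: hst_adj_def hst_child_def prefix_snoc)

lemma path_stays_inside_subtree:
  assumes "successively hst_adj p" "p \<noteq> []" "prefix (x @ [a]) (hd p)" "x \<notin> set p"
  shows "prefix (x @ [a]) (last p)"
  using assms
proof (induction p)
  case (Cons u p)
  show ?case
  proof (cases "p = []")
    case False
    then have "hst_adj u (hd p)" "x \<noteq> hd p"
      using Cons.prems by (auto simp: successively_Cons)
    then have "prefix (x @ [a]) (hd p)"
      using hst_adj_leave_subtree Cons.prems(3) by fastforce
    then show ?thesis
      using Cons False by (simp add: successively_Cons)
  qed (use Cons.prems in simp)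
qed simp

text \<open>The first step of a simple path is forced: towards the target if it lies below the
  starting point, and to the parent otherwise.\<close>

lemma hst_path_first_step:
  assumes "hst_path b \<delta> x y (x # z # p)"
  shows "z = (if prefix x y then x @ [y ! length x] else butlast x)"
proof -
  have path: "hst_adj x z" "successively hst_adj (z # p)" "x \<notin> set (z # p)" "last (z # p) = y"
    using assms by (auto simp: hst_path_def)
  from \<open>hst_adj x z\<close> consider a where "z = x @ [a]" | a where "x = z @ [a]"
    by (auto simp: hst_adj_def hst_child_def)
  then show ?thesis
  proof cases
    case 1
    \<comment> \<open>A simple path that has stepped down cannot return to \<open>x\<close>, so its
      target lies below the chosen child, which fixes \<open>a\<close>.\<close>
    then have "prefix (x @ [a]) y"
      using path_stays_inside_subtree[of "z # p" x a] path by simp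
    then show ?thesis
      using 1 by (auto simp: prefix_def)
  next
    case 2
    then have "\<not> prefix x y"
      using path_stays_outside_subtree[of "z # p" x] path by simp
    then show ?thesis
      using 2 by simp
  qed
qed

text \<open>The first step depends only on the two endpoints, so the two paths agree step by
  step.\<close>

lemma hst_path_unique:
  assumes "hst_path b \<delta> x y p" "hst_path b \<delta> x y q"
  shows "p = q"
  using assms
proof (induction p arbitrary: x q)
  case Nil
  then show ?case by (simp add: hst_path_def)
next
  case (Cons u p)
  have u: "u = x" using Cons.prems by (simp add: hst_path_def)
  obtain q' where q: "q = x # q'" using Cons.prems(2) by (cases q) (auto simp: hst_path_def)
  show ?case
  proof (cases "p = [] \<or> q' = []")
    case True
    \<comment> \<open>One of the paths is a single vertex, so the endpoints coincide, and
      distinctness makes the other path a single vertex too.\<close>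
    then have "x = y" using Cons.prems u q by (auto simp: hst_path_def)
    then show ?thesis using Cons.prems u q
      by (cases p; cases q') (auto simp: hst_path_def split: if_splits)
  next
    case False
    then obtain z p' z' q'' where *: "p = z # p'" "q' = z' # q''"
      by (metis neq_Nil_conv)
    then have "z = z'"
      using hst_path_first_step Cons.prems u q by metis
    have "hst_path b \<delta> z y p" "hst_path b \<delta> z y q'"
      using Cons.prems u q * \<open>z = z'\<close> by (auto simp: hst_path_def)
    then show ?thesis using Cons.IH u q by blast
  qed
qed

section \<open>Explicit paths and their weights\<close>

lemma hst_dist_eqI:
  assumes "hst_path b \<delta> x y p"
  shows "hst_dist b \<delta> lam x y = hst_path_weight lam p"
proof -
  have "(THE p. hst_path b \<delta> x y p) = p"
    using assms by (intro the_equality) (auto intro: hst_path_unique)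
  then show ?thesis by (simp add: hst_dist_def)
qed

lemma hst_path_weight_Cons:
  "p \<noteq> [] \<Longrightarrow> hst_path_weight lam (u # p) = hst_edge_weight lam u (hd p) + hst_path_weight lam p"
  by (cases p) (auto simp: hst_path_weight_def)

lemma hst_path_Cons:
  assumes "hst_path b \<delta> x y p" "hst_adj u x" "u \<in> hst_vertices b \<delta>" "u \<notin> set p"
  shows "hst_path b \<delta> u y (u # p)"
  using assms by (auto simp: hst_path_def successively_Cons)

lemma hst_vertices_prefix: "v \<in> hst_vertices b \<delta> \<Longrightarrow> prefix u v \<Longrightarrow> u \<in> hst_vertices b \<delta>"
  by (auto simp: hst_vertices_def prefix_def)

text \<open>Locating the vertices of \<open>p\<close> between \<open>c\<close> and
  \<open>c @ v\<close> strengthens the induction: it shows that a vertex put in front of a path is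
  new. The climbing part in \<open>hst_path_up_down\<close> relies on it again.\<close>

lemma hst_path_down:
  assumes "c @ v \<in> hst_vertices b \<delta>"
  shows "\<exists>p. hst_path b \<delta> c (c @ v) p \<and> (\<forall>w\<in>set p. prefix c w \<and> prefix w (c @ v)) \<and>
           hst_path_weight lam p = (\<Sum>k\<in>{length c<..length (c @ v)}. lam ^ k)"
  using assms
proof (induction v arbitrary: c)
  case Nil
  then show ?case
    by (intro exI[of _ "[c]"]) (auto simp: hst_path_def hst_path_weight_def)
next
  case (Cons a v)
  then obtain p where p: "hst_path b \<delta> (c @ [a]) (c @ a # v) p"
      "\<forall>w\<in>set p. prefix (c @ [a]) w \<and> prefix w (c @ a # v)"
      "hst_path_weight lam p = (\<Sum>k\<in>{Suc (length c)<..length (c @ a # v)}. lam ^ k)"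
    using Cons.IH[of "c @ [a]"] by auto
  have "c \<in> hst_vertices b \<delta>"
    using Cons.prems hst_vertices_prefix by auto
  moreover have "c \<notin> set p"
    using p(2) by auto
  ultimately have "hst_path b \<delta> c (c @ a # v) (c # p)"
    using p(1) by (intro hst_path_Cons) (auto simp: hst_adj_def hst_child_def)
  moreover have "{length c<..length (c @ a # v)} =
      insert (Suc (length c)) {Suc (length c)<..length (c @ a # v)}" by auto
  then have "hst_path_weight lam (c # p) = (\<Sum>k\<in>{length c<..length (c @ a # v)}. lam ^ k)"
    using p(1,3) by (subst hst_path_weight_Cons) (auto simp: hst_path_def hst_edge_weight_def)
  moreover have "\<forall>w\<in>set (c # p). prefix c w \<and> prefix w (c @ a # v)"
    using p(2) by (auto dest: append_prefixD)
  ultimately show ?case by blast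
qed

text \<open>The third hypothesis makes \<open>c\<close> the lowest common ancestor. Extending
  \<open>u\<close> at its end puts a deeper starting vertex in front of the path; as it lies on
  neither the branch to \<open>c @ u\<close> nor the one to \<open>c @ v\<close>, the path stays
  simple.\<close>

lemma hst_path_up_down:
  assumes "c @ u \<in> hst_vertices b \<delta>" "c @ v \<in> hst_vertices b \<delta>"
    and "u = [] \<or> v = [] \<or> hd u \<noteq> hd v"
  shows "\<exists>p. hst_path b \<delta> (c @ u) (c @ v) p \<and>
           (\<forall>w\<in>set p. prefix w (c @ u) \<or> prefix w (c @ v)) \<and>
           hst_path_weight lam p = (\<Sum>k\<in>{length c<..length (c @ u)}. lam ^ k) +
             (\<Sum>k\<in>{length c<..length (c @ v)}. lam ^ k)"
  using assms
proof (induction u rule: rev_induct)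
  case Nil
  then show ?case using hst_path_down[of c v b \<delta> lam] by fastforce
next
  case (snoc a u)
  have "c @ u \<in> hst_vertices b \<delta>"
    using snoc.prems(1) hst_vertices_prefix[of "c @ u @ [a]" b \<delta> "c @ u"] by auto
  moreover have "u = [] \<or> v = [] \<or> hd u \<noteq> hd v"
    using snoc.prems(3) by (cases u) auto
  ultimately obtain p where p: "hst_path b \<delta> (c @ u) (c @ v) p"
      "\<forall>w\<in>set p. prefix w (c @ u) \<or> prefix w (c @ v)"
      "hst_path_weight lam p = (\<Sum>k\<in>{length c<..length (c @ u)}. lam ^ k) +
             (\<Sum>k\<in>{length c<..length (c @ v)}. lam ^ k)"
    using snoc.IH snoc.prems(2) by blast
  have "\<not> prefix (c @ u @ [a]) (c @ u)"
    by (auto dest: prefix_length_le)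
  moreover have "\<not> prefix (c @ u @ [a]) (c @ v)"
    using snoc.prems(3) by (cases u; cases v) auto
  ultimately have notin: "c @ u @ [a] \<notin> set p"
    using p(2) by blast
  have "hst_path b \<delta> (c @ u @ [a]) (c @ v) ((c @ u @ [a]) # p)"
    using p(1) snoc.prems(1) notin
    by (intro hst_path_Cons) (auto simp: hst_adj_def hst_child_def)
  moreover have "{length c<..length (c @ u @ [a])} =
      insert (Suc (length (c @ u))) {length c<..length (c @ u)}" by auto
  then have "hst_path_weight lam ((c @ u @ [a]) # p) =
      (\<Sum>k\<in>{length c<..length (c @ u @ [a])}. lam ^ k) +
      (\<Sum>k\<in>{length c<..length (c @ v)}. lam ^ k)"
    using p(1,3) by (subst hst_path_weight_Cons) (auto simp: hst_path_def hst_edge_weight_def)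
  moreover have "\<forall>w\<in>set ((c @ u @ [a]) # p). prefix w (c @ u @ [a]) \<or> prefix w (c @ v)"
    using p(2) by (auto simp flip: append_assoc)
  ultimately show ?case by blast
qed

text \<open>The path climbs to the longest common prefix \<open>c\<close> and descends again. Both
  leaves have level \<delta>, so each half crosses every level \<open>k\<close> with
  \<open>length c < k\<close> once, and these are the levels where the ancestors differ.\<close>

lemma hst_dist_leaves:
  assumes "x \<in> hst_leaves b \<delta>" "y \<in> hst_leaves b \<delta>"
  shows "hst_dist b \<delta> lam x y = (\<Sum>k=1..\<delta>. lam ^ k * (if take k x = take k y then 0 else 2))"
proof -
  have xy: "x \<in> hst_vertices b \<delta>" "y \<in> hst_vertices b \<delta>" "length x = \<delta>" "length y = \<delta>"
    using assms by (auto simp: hst_leaves_def)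
  have "\<exists>c u v. x = c @ u \<and> y = c @ v \<and> (u = [] \<or> v = [] \<or> hd u \<noteq> hd v)"
  proof (cases "x = y")
    case False
    with xy have "x \<parallel> y"
      by (simp add: not_equal_is_parallel)
    then show ?thesis
      using parallel_decomp[of x y] by fastforce
  qed (intro exI[of _ x] exI[of _ "[]"], simp)
  then obtain c u v where cuv: "x = c @ u" "y = c @ v" "u = [] \<or> v = [] \<or> hd u \<noteq> hd v"
    by blast
  have take_iff: "take k x = take k y \<longleftrightarrow> k \<le> length c" if "k \<le> \<delta>" for k
  proof (cases "k \<le> length c")
    case False
    then obtain m where m: "k = length c + Suc m"
      using less_imp_Suc_add not_le by (metis add_Suc_right)
    \<comment> \<open>Both leaves have length at least \<open>k > length c\<close>, which leaves
      only the alternative \<open>hd u \<noteq> hd v\<close>.\<close>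
    then have "u \<noteq> []" "v \<noteq> []" using that xy cuv by auto
    then show ?thesis using cuv m by (cases u; cases v) auto
  qed (use cuv in simp)
  obtain p where "hst_path b \<delta> x y p"
      "hst_path_weight lam p = (\<Sum>k\<in>{length c<..\<delta>}. lam ^ k) + (\<Sum>k\<in>{length c<..\<delta>}. lam ^ k)"
    using hst_path_up_down[of c u b \<delta> v lam] cuv xy by auto
  then have "hst_dist b \<delta> lam x y = (\<Sum>k\<in>{length c<..\<delta>}. lam ^ k * 2)"
    by (simp add: hst_dist_eqI flip: sum_distrib_right)
  also have "\<dots> = (\<Sum>k=1..\<delta>. lam ^ k * (if take k x = take k y then 0 else 2))"
    by (rule sum.mono_neutral_cong_left) (auto simp: take_iff)
  finally show ?thesis .
qed

subsection \<open>Greedy matchings\<close>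

lemma finite_matching_pairs:
  assumes "finite P"
  shows "finite {(i, j). i < j \<and> {i, j} \<in> (P :: nat set set)}"
proof (rule finite_imageD)
  show "finite ((\<lambda>(i, j). {i, j}) ` {(i, j). i < j \<and> {i, j} \<in> P})"
    by (rule finite_subset[OF _ assms]) auto
qed (auto simp: inj_on_def doubleton_eq_iff)

lemma matching_cost_insert:
  assumes "finite P" "{i, j} \<notin> P" "i < j"
  shows "matching_cost d X (insert {i, j} P) = d (X i) (X j) + matching_cost d X P"
proof -
  have "{(i', j'). i' < j' \<and> {i', j'} \<in> insert {i, j} P} =
      insert (i, j) {(i', j'). i' < j' \<and> {i', j'} \<in> P}"
    using assms(3) by (auto simp: doubleton_eq_iff)
  then show ?thesis
    using assms finite_matching_pairs[OF assms(1)] by (simp add: matching_cost_def)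
qed

lemma finite_perfect_matchings: "finite I \<Longrightarrow> finite (perfect_matchings I)"
  by (rule finite_subset[of _ "Pow (Pow I)"]) (auto simp: perfect_matchings_def partition_on_def)

lemma finite_hst_leaves: "finite (hst_leaves b \<delta>)"
  and card_hst_leaves: "card (hst_leaves b \<delta>) = b ^ \<delta>"
proof -
  have *: "hst_leaves b \<delta> = {v. set v \<subseteq> {..<b} \<and> length v = \<delta>}"
    by (auto simp: hst_leaves_def hst_vertices_def)
  show "finite (hst_leaves b \<delta>)" "card (hst_leaves b \<delta>) = b ^ \<delta>"
    unfolding * by (simp_all add: finite_lists_length_eq card_lists_length_eq)
qed

text \<open>\<open>take k x\<close> is the ancestor of \<open>x\<close> at level \<open>k\<close>,
  and \<open>hst_leaves b k\<close> serves as the set of all level-\<open>k\<close> vertices of the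
  deeper tree.\<close>

lemma take_hst_leaves: "x \<in> hst_leaves b \<delta> \<Longrightarrow> k \<le> \<delta> \<Longrightarrow> take k x \<in> hst_leaves b k"
  using set_take_subset[of k x] by (auto simp: hst_leaves_def hst_vertices_def)

text \<open>Pigeonhole at the deepest level \<open>m\<close> with \<open>b ^ m < card I\<close>.
  Agreement at level \<open>m\<close> implies agreement at all levels above it, so one pair serves
  every \<open>k\<close> at once.\<close>

lemma close_pair_exists:
  assumes "finite I" "card I \<ge> 2" "\<And>i. i \<in> I \<Longrightarrow> X i \<in> hst_leaves b \<delta>"
  shows "\<exists>i\<in>I. \<exists>j\<in>I. i < j \<and>
           (\<forall>k\<le>\<delta>. take k (X i) = take k (X (j::nat)) \<or> card I \<le> b ^ k)"
proof -
  define K where "K = {k. k \<le> \<delta> \<and> b ^ k < card I}"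
  have fin: "finite K" and "0 \<in> K" using assms(2) by (auto simp: K_def)
  define m where "m = Max K"
  have "m \<in> K" unfolding m_def using fin \<open>0 \<in> K\<close> by (intro Max_in) auto
  then have m: "m \<le> \<delta>" "b ^ m < card I" by (auto simp: K_def)
  have "card ((\<lambda>i. take m (X i)) ` I) \<le> card (hst_leaves b m)"
    using assms(3) m(1) by (intro card_mono finite_hst_leaves) (auto intro: take_hst_leaves)
  then have "\<not> inj_on (\<lambda>i. take m (X i)) I"
    using m(2) by (intro pigeonhole) (simp add: card_hst_leaves)
  then obtain i j where ij: "i \<in> I" "j \<in> I" "i < j" "take m (X i) = take m (X j)"
    unfolding inj_on_def by (metis linorder_neqE_nat)
  have "take k (X i) = take k (X j) \<or> card I \<le> b ^ k" if "k \<le> \<delta>" for k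
  proof (cases "k \<le> m")
    case True
    then show ?thesis using ij(4) by (metis min.absorb1 take_take)
  next
    case False
    then have "k \<notin> K" using fin Max_ge unfolding m_def by blast
    then show ?thesis using that by (auto simp: K_def)
  qed
  then show ?thesis using ij by blast
qed

lemma perfect_matching_insert:
  assumes "P \<in> perfect_matchings J" "i \<notin> J" "j \<notin> J" "i \<noteq> j"
  shows "insert {i, j} P \<in> perfect_matchings (insert i (insert j J))"
proof -
  have "\<Union>P = J" using assms(1) by (auto simp: perfect_matchings_def partition_on_def)
  then have "disjnt {i, j} (\<Union>P)" using assms by (auto simp: disjnt_iff)
  moreover have "insert i (insert j J) - {i, j} = J" using assms by auto
  ultimately show ?thesis using assms
    by (auto simp: perfect_matchings_def partition_on_insert)
qed

text \<open>The minimum with \<open>card I\<close> is what lets the induction close: a pair charged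
  at level \<open>k\<close> also uses up two of the at most \<open>b ^ k\<close> points left, so the
  budget of that level drops by the 2 just paid.\<close>

lemma greedy_matching:
  assumes "0 \<le> lam" "finite I" "\<And>i. i \<in> I \<Longrightarrow> X i \<in> hst_leaves b \<delta>"
  shows "\<exists>J\<subseteq>I. card (I - J) = card I mod 2 \<and> (\<exists>P\<in>perfect_matchings J.
           matching_cost (hst_dist b \<delta> lam) X P \<le>
             (\<Sum>k=1..\<delta>. lam ^ k * real (min (b ^ k) (card I))))"
  using assms(2,3)
proof (induction "card I" arbitrary: I rule: less_induct)
  case less
  show ?case
  proof (cases "card I \<ge> 2")
    case False
    have "{} \<in> perfect_matchings {}" "matching_cost (hst_dist b \<delta> lam) X {} = 0"
      by (auto simp: perfect_matchings_def partition_on_empty matching_cost_def)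
    moreover have "0 \<le> (\<Sum>k=1..\<delta>. lam ^ k * real (min (b ^ k) (card I)))"
      using assms(1) by (intro sum_nonneg) auto
    ultimately show ?thesis
      using False by (intro exI[of _ "{}"] conjI bexI[of _ "{}"]) auto
  next
    case True
    then obtain i j where ij: "i \<in> I" "j \<in> I" "i < j"
        "\<And>k. k \<le> \<delta> \<Longrightarrow> take k (X i) = take k (X j) \<or> card I \<le> b ^ k"
      using close_pair_exists[of I X b \<delta>] less.prems by auto
    define I' where "I' = I - {i, j}"
    have cardI: "card I = card I' + 2"
      using ij less.prems(1) True by (simp add: I'_def card_Diff_subset)
    have cost_ij: "hst_dist b \<delta> lam (X i) (X j) \<le>
        (\<Sum>k=1..\<delta>. lam ^ k * (if card I \<le> b ^ k then 2 else 0))"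
      unfolding hst_dist_leaves[OF less.prems(2)[OF ij(1)] less.prems(2)[OF ij(2)]]
      using ij(4) assms(1) by (intro sum_mono) fastforce
    obtain J P where J: "J \<subseteq> I'" "card (I' - J) = card I' mod 2" "P \<in> perfect_matchings J"
        "matching_cost (hst_dist b \<delta> lam) X P \<le>
          (\<Sum>k=1..\<delta>. lam ^ k * real (min (b ^ k) (card I')))"
      using less.hyps[of I'] less.prems cardI by (auto simp: I'_def)
    have notin: "i \<notin> J" "j \<notin> J" using J(1) by (auto simp: I'_def)
    have "finite P" "{i, j} \<notin> P"
    proof -
      have "J = \<Union>P" using J(3) by (auto simp: perfect_matchings_def partition_on_def)
      moreover have "finite J" using J(1) less.prems(1) by (auto simp: I'_def intro: finite_subset)
      ultimately show "finite P" "{i, j} \<notin> P" using notin by (auto intro: finite_UnionD)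
    qed
    then have "matching_cost (hst_dist b \<delta> lam) X (insert {i, j} P) \<le>
        (\<Sum>k=1..\<delta>. lam ^ k * (if card I \<le> b ^ k then 2 else 0)) +
        (\<Sum>k=1..\<delta>. lam ^ k * real (min (b ^ k) (card I')))"
      using ij(3) J(4) cost_ij by (simp add: matching_cost_insert)
    also have "\<dots> = (\<Sum>k=1..\<delta>. lam ^ k *
        ((if card I \<le> b ^ k then 2 else 0) + real (min (b ^ k) (card I'))))"
      by (simp add: sum.distrib distrib_left)
    also have "\<dots> \<le> (\<Sum>k=1..\<delta>. lam ^ k * real (min (b ^ k) (card I)))"
    proof -
      \<comment> \<open>If \<open>card I \<le> c\<close>, the minima are \<open>card I'\<close> and
        \<open>card I\<close>, which differ by exactly 2; otherwise nothing is charged and the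
        minimum is monotone.\<close>
      have "(if card I \<le> c then 2 else 0) + real (min c (card I')) \<le> real (min c (card I))" for c
        using cardI by auto
      then show ?thesis using assms(1) by (intro sum_mono mult_left_mono) auto
    qed
    finally have "matching_cost (hst_dist b \<delta> lam) X (insert {i, j} P) \<le> \<dots>" .
    moreover have "insert {i, j} P \<in> perfect_matchings (insert i (insert j J))"
      using J(3) notin ij(3) by (intro perfect_matching_insert) auto
    moreover have "insert i (insert j J) \<subseteq> I" "I - insert i (insert j J) = I' - J"
      using ij J(1) by (auto simp: I'_def)
    ultimately show ?thesis
      using J(2) cardI by (intro exI[of _ "insert i (insert j J)"]) auto
  qed
qed


text \<open>The greedy construction is run on the one-vertex tree with all points at
  \<open>[]\<close>; only the existence of its matching matters. This makes the \<open>Min\<close>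
  over perfect matchings meaningful.\<close>

lemma perfect_matchings_nonempty:
  assumes "finite I" "even (card I)"
  shows "perfect_matchings I \<noteq> {}"
proof -
  obtain J where "J \<subseteq> I" "card (I - J) = card I mod 2" "perfect_matchings J \<noteq> {}"
    using greedy_matching[of 0 I "\<lambda>_. []" 0 0] assms(1)
    by (auto simp: hst_leaves_def hst_vertices_def)
  moreover from this assms have "I - J = {}" by (simp add: even_iff_mod_2_eq_zero)
  ultimately show ?thesis by (metis Diff_eq_empty_iff subset_antisym)
qed

section \<open>The pointwise upper bound\<close>

lemma min_perfect_matching_le:
  "finite I \<Longrightarrow> P \<in> perfect_matchings I \<Longrightarrow> min_perfect_matching d I X \<le> matching_cost d X P"
  unfolding min_perfect_matching_def by (intro Min_le) (auto simp: finite_perfect_matchings)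

lemma min_matching_le:
  assumes "0 \<le> lam" "finite I" "\<And>i. i \<in> I \<Longrightarrow> X i \<in> hst_leaves b \<delta>"
  shows "min_matching (hst_dist b \<delta> lam) I X \<le> (\<Sum>k=1..\<delta>. (real b * lam) ^ k)"
proof -
  obtain J P where J: "J \<subseteq> I" "card (I - J) = card I mod 2" "P \<in> perfect_matchings J"
      "matching_cost (hst_dist b \<delta> lam) X P \<le>
        (\<Sum>k=1..\<delta>. lam ^ k * real (min (b ^ k) (card I)))"
    using greedy_matching[of lam I X b \<delta>] assms by blast
  \<comment> \<open>\<open>J\<close> misses \<open>card I mod 2\<close> points, so it is
    \<open>I\<close> itself or one of the sets allowed after discarding a point.\<close>
  have "min_matching (hst_dist b \<delta> lam) I X \<le> min_perfect_matching (hst_dist b \<delta> lam) J X"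
  proof (cases "even (card I)")
    case True
    then have "I - J = {}" using J(2) assms(2) by (simp add: even_iff_mod_2_eq_zero)
    then have "J = I" using J(1) by auto
    then show ?thesis using True by (simp add: min_matching_def)
  next
    case False
    then have "card (I - J) = 1" using J(2) by (simp add: odd_iff_mod_2_eq_one)
    then obtain i where "I - J = {i}" by (auto simp: card_1_singleton_iff)
    then have "i \<in> I" "J = I - {i}" using J(1) by auto
    then show ?thesis using False assms(2) by (auto simp: min_matching_def intro!: Min_le)
  qed
  also have "\<dots> \<le> matching_cost (hst_dist b \<delta> lam) X P"
    using J(1,3) assms(2) by (intro min_perfect_matching_le) (auto intro: finite_subset)
  also note J(4)
  also have "(\<Sum>k=1..\<delta>. lam ^ k * real (min (b ^ k) (card I))) \<le>
      (\<Sum>k=1..\<delta>. lam ^ k * real (b ^ k))"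
    using assms(1) by (intro sum_mono mult_left_mono) auto
  also have "\<dots> = (\<Sum>k=1..\<delta>. (real b * lam) ^ k)"
    by (simp add: power_mult_distrib mult.commute)
  finally show ?thesis .
qed

subsection \<open>Odd classes\<close>

text \<open>With \<open>f i = take k (X i)\<close> these are the level-\<open>k\<close> vertices
  that have an odd number of points below them.\<close>

definition odd_classes :: "(nat \<Rightarrow> 'a) \<Rightarrow> nat set \<Rightarrow> 'a set" where
  "odd_classes f J = {v. odd (card {i \<in> J. f i = v})}"

text \<open>A new point flips the parity of its own class only: the right-hand side is the symmetric
  difference with \<open>{f i}\<close>.\<close>

lemma odd_classes_insert:
  assumes "finite J" "i \<notin> J"
  shows "odd_classes f (insert i J) = (odd_classes f J - {f i}) \<union> ({f i} - odd_classes f J)"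
proof -
  have "{j \<in> insert i J. f j = v} =
      (if f i = v then insert i {j \<in> J. f j = v} else {j \<in> J. f j = v})" for v
    by auto
  then show ?thesis using assms by (auto simp: odd_classes_def)
qed

lemma odd_classes_subset: "odd_classes f J \<subseteq> f ` J"
proof
  fix v assume "v \<in> odd_classes f J"
  then have "card {i \<in> J. f i = v} \<noteq> 0"
    unfolding odd_classes_def by (auto intro!: Nat.gr0I)
  then have "{i \<in> J. f i = v} \<noteq> {}"
    by (metis card.empty)
  then show "v \<in> f ` J" by blast
qed

lemma card_odd_classes_insert_le:
  assumes "finite J" "i \<notin> J"
  shows "card (odd_classes f (insert i J)) \<le> card (odd_classes f J) + 1"
proof -
  have "finite (odd_classes f J)"
    using odd_classes_subset[of f J] assms(1) by (meson finite_imageI finite_subset)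
  then have "card (odd_classes f (insert i J)) \<le> card (insert (f i) (odd_classes f J))"
    unfolding odd_classes_insert[OF assms] by (intro card_mono) auto
  also have "\<dots> \<le> card (odd_classes f J) + 1"
    by (simp add: card_insert_le_m1 card_insert_if)
  finally show ?thesis .
qed

text \<open>Two flips of the same class cancel; otherwise each flip adds at most one odd
  class.\<close>

lemma card_odd_classes_insert_pair_le:
  assumes "finite J" "i \<notin> J" "j \<notin> J" "i \<noteq> j"
  shows "card (odd_classes f (insert i (insert j J))) \<le>
    card (odd_classes f J) + (if f i = f j then 0 else 2)"
proof (cases "f i = f j")
  case True
  then have "odd_classes f (insert i (insert j J)) = odd_classes f J"
    using assms by (auto simp: odd_classes_insert)
  then show ?thesis by simp
next
  case False
  then show ?thesis
    using card_odd_classes_insert_le[of "insert j J" i f] card_odd_classes_insert_le[of J j f] assms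
    by simp
qed

text \<open>The matching is built up edge by edge. At level \<open>k\<close> an edge creates odd
  classes only if its endpoints have different ancestors there, and then at most 2, which is exactly
  the factor its distance pays at that level.\<close>

lemma matching_cost_ge:
  assumes "0 \<le> lam" "finite J" "P \<in> perfect_matchings J" "\<And>i. i \<in> J \<Longrightarrow> X i \<in> hst_leaves b \<delta>"
  shows "(\<Sum>k=1..\<delta>. lam ^ k * real (card (odd_classes (\<lambda>i. take k (X i)) J))) \<le>
    matching_cost (hst_dist b \<delta> lam) X P"
proof -
  have "finite P"
    using assms(2,3) by (auto simp: perfect_matchings_def partition_on_def intro: finite_UnionD)
  then show ?thesis using assms(2-)
  proof (induction P arbitrary: J rule: finite_induct)
    case empty
    then have "J = {}" by (auto simp: perfect_matchings_def partition_on_def)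
    then show ?case by (simp add: odd_classes_def matching_cost_def)
  next
    case (insert e P)
    have "card e = 2" using insert.prems(2) by (simp add: perfect_matchings_def)
    then obtain i j where ij: "e = {i, j}" "i < j"
      by (metis card_2_iff insert_commute linorder_neqE_nat)
    have part: "partition_on J (insert e P)" and two: "\<forall>e\<in>P. card e = 2"
      using insert.prems(2) by (auto simp: perfect_matchings_def)
    have "e \<inter> p = {}" if "p \<in> P" for p
      using disjointD[OF partition_onD2[OF part], of e p] insert.hyps(2) that by auto
    then have "disjnt e (\<Union>P)"
      unfolding disjnt_def by blast
    then have P: "P \<in> perfect_matchings (J - e)" "e \<subseteq> J"
      using part two by (auto simp: perfect_matchings_def partition_on_insert)
    have J: "J = insert i (insert j (J - e))" using P(2) ij by auto
    have "real (card (odd_classes (\<lambda>i. take k (X i)) J)) \<le>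
        (if take k (X i) = take k (X j) then 0 else 2) +
        real (card (odd_classes (\<lambda>i. take k (X i)) (J - e)))" for k
      using card_odd_classes_insert_pair_le[of "J - e" i j "\<lambda>i. take k (X i)"]
        ij insert.prems(1) J by (auto split: if_splits)
    then have "(\<Sum>k=1..\<delta>. lam ^ k * real (card (odd_classes (\<lambda>i. take k (X i)) J))) \<le>
        (\<Sum>k=1..\<delta>. lam ^ k * ((if take k (X i) = take k (X j) then 0 else 2) +
          real (card (odd_classes (\<lambda>i. take k (X i)) (J - e)))))"
      using assms(1) by (intro sum_mono mult_left_mono) auto
    also have "\<dots> = hst_dist b \<delta> lam (X i) (X j) +
        (\<Sum>k=1..\<delta>. lam ^ k * real (card (odd_classes (\<lambda>i. take k (X i)) (J - e))))"
      using insert.prems(3) P(2) ij by (simp add: hst_dist_leaves distrib_left sum.distrib)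
    also have "\<dots> \<le> hst_dist b \<delta> lam (X i) (X j) + matching_cost (hst_dist b \<delta> lam) X P"
      using insert.IH[OF _ P(1)] insert.prems by simp
    also have "\<dots> = matching_cost (hst_dist b \<delta> lam) X (insert e P)"
      using insert.hyps ij by (simp add: matching_cost_insert)
    finally show ?case .
  qed
qed

lemma min_perfect_matching_ge:
  assumes "0 \<le> lam" "finite J" "even (card J)" "\<And>i. i \<in> J \<Longrightarrow> X i \<in> hst_leaves b \<delta>"
  shows "(\<Sum>k=1..\<delta>. lam ^ k * real (card (odd_classes (\<lambda>i. take k (X i)) J))) \<le>
    min_perfect_matching (hst_dist b \<delta> lam) J X"
  unfolding min_perfect_matching_def
  using assms matching_cost_ge[OF assms(1,2) _ assms(4)]
  by (subst Min_ge_iff) (auto simp: finite_perfect_matchings perfect_matchings_nonempty)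

text \<open>Discarding one point removes at most one odd class per level, hence the subtracted
  parity. The terms may then be negative, so the set \<open>K\<close> of levels is left free; it is
  enlarged to all levels only once the terms are nonnegative again.\<close>

lemma min_matching_ge:
  assumes "0 \<le> lam" "finite I" "I \<noteq> {}" "\<And>i. i \<in> I \<Longrightarrow> X i \<in> hst_leaves b \<delta>" "K \<subseteq> {1..\<delta>}"
  shows "(\<Sum>k\<in>K. lam ^ k * (real (card (odd_classes (\<lambda>i. take k (X i)) I)) - real (card I mod 2))) \<le>
    min_matching (hst_dist b \<delta> lam) I X"
proof (cases "even (card I)")
  case True
  have "(\<Sum>k\<in>K. lam ^ k * real (card (odd_classes (\<lambda>i. take k (X i)) I))) \<le>
      (\<Sum>k=1..\<delta>. lam ^ k * real (card (odd_classes (\<lambda>i. take k (X i)) I)))"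
    using assms(1,5) by (intro sum_mono2) auto
  also have "\<dots> \<le> min_matching (hst_dist b \<delta> lam) I X"
    using True min_perfect_matching_ge[OF assms(1,2) _ assms(4)] by (simp add: min_matching_def)
  finally show ?thesis using True by (simp add: even_iff_mod_2_eq_zero)
next
  case False
  have "(\<Sum>k\<in>K. lam ^ k * (real (card (odd_classes (\<lambda>i. take k (X i)) I)) - 1)) \<le>
      min_perfect_matching (hst_dist b \<delta> lam) (I - {i}) X" if i: "i \<in> I" for i
  proof -
    have "real (card (odd_classes f I)) - 1 \<le> real (card (odd_classes f (I - {i})))"
      for f :: "nat \<Rightarrow> nat list"
      using card_odd_classes_insert_le[of "I - {i}" i f] i assms(2) by (simp add: insert_absorb)
    then have "(\<Sum>k\<in>K. lam ^ k * (real (card (odd_classes (\<lambda>i. take k (X i)) I)) - 1)) \<le>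
        (\<Sum>k\<in>K. lam ^ k * real (card (odd_classes (\<lambda>i. take k (X i)) (I - {i}))))"
      using assms(1) by (intro sum_mono mult_left_mono) auto
    also have "\<dots> \<le> (\<Sum>k=1..\<delta>. lam ^ k * real (card (odd_classes (\<lambda>i. take k (X i)) (I - {i}))))"
      using assms(1,5) by (intro sum_mono2) auto
    also have "\<dots> \<le> min_perfect_matching (hst_dist b \<delta> lam) (I - {i}) X"
      using assms(2,4) i False by (intro min_perfect_matching_ge assms(1)) auto
    finally show ?thesis .
  qed
  moreover have "real (card I mod 2) = 1"
    using False by (simp add: odd_iff_mod_2_eq_one)
  ultimately show ?thesis
    using False assms(2,3) by (auto simp: min_matching_def)
qed

subsection \<open>Expectations\<close>

lemma set_random_leaves:
  assumes "b > 0"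
  shows "set_pmf (random_leaves b \<delta> n) = PiE_dflt {..<n} [] (\<lambda>_. hst_leaves b \<delta>)"
proof -
  have "hst_leaves b \<delta> \<noteq> {}"
    using card_hst_leaves[of b \<delta>] assms by fastforce
  then show ?thesis
    by (simp add: random_leaves_def set_Pi_pmf finite_hst_leaves comp_def)
qed

lemma random_leaves_in_leaves:
  "b > 0 \<Longrightarrow> X \<in> set_pmf (random_leaves b \<delta> n) \<Longrightarrow> i < n \<Longrightarrow> X i \<in> hst_leaves b \<delta>"
  by (auto simp: set_random_leaves PiE_dflt_def)

lemma integrable_random_leaves:
  fixes f :: "(nat \<Rightarrow> nat list) \<Rightarrow> real"
  assumes "b > 0"
  shows "integrable (measure_pmf (random_leaves b \<delta> n)) f"
  using assms by (intro integrable_measure_pmf_finite) (auto simp: set_random_leaves finite_hst_leaves)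

text \<open>Independence of the coordinates turns the expected product into a product of
  \<open>n\<close> equal averages over the leaves.\<close>

lemma expectation_random_leaves_prod:
  fixes g :: "nat list \<Rightarrow> real"
  assumes "b > 0"
  shows "measure_pmf.expectation (random_leaves b \<delta> n) (\<lambda>X. \<Prod>i<n. g (X i)) =
    ((\<Sum>x\<in>hst_leaves b \<delta>. g x) / real (b ^ \<delta>)) ^ n"
proof -
  let ?p = "pmf_of_set (hst_leaves b \<delta>)"
  have ne: "hst_leaves b \<delta> \<noteq> {}"
    using card_hst_leaves[of b \<delta>] assms by fastforce
  have single: "measure_pmf.expectation (random_leaves b \<delta> n) (\<lambda>X. g (X i)) =
      (\<Sum>x\<in>hst_leaves b \<delta>. g x) / real (b ^ \<delta>)" if "i < n" for i
  proof -
    have "measure_pmf.expectation (random_leaves b \<delta> n) (\<lambda>X. g (X i)) =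
        measure_pmf.expectation (map_pmf (\<lambda>X. X i) (random_leaves b \<delta> n)) g"
      by simp
    also have "map_pmf (\<lambda>X. X i) (random_leaves b \<delta> n) = ?p"
      using that by (simp add: random_leaves_def Pi_pmf_component)
    finally show ?thesis
      using ne by (simp add: integral_pmf_of_set finite_hst_leaves card_hst_leaves)
  qed
  have "measure_pmf.expectation (random_leaves b \<delta> n) (\<lambda>X. \<Prod>i<n. g (X i)) =
      (\<Prod>i<n. measure_pmf.expectation (random_leaves b \<delta> n) (\<lambda>X. g (X i)))"
  proof (rule prob_space.indep_vars_lebesgue_integral[OF measure_pmf.prob_space_axioms])
    show "prob_space.indep_vars (measure_pmf (random_leaves b \<delta> n)) (\<lambda>_. borel)
        (\<lambda>i X. g (X i)) {..<n}"
      unfolding random_leaves_def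
      by (rule prob_space.indep_vars_compose2[OF measure_pmf.prob_space_axioms indep_vars_Pi_pmf])
        auto
  qed (auto intro: integrable_random_leaves[OF assms])
  then show ?thesis by (simp add: single)
qed

lemma card_leaves_below:
  assumes "v \<in> hst_leaves b k" "k \<le> \<delta>"
  shows "card {x \<in> hst_leaves b \<delta>. take k x = v} = b ^ (\<delta> - k)"
proof -
  have "{x \<in> hst_leaves b \<delta>. take k x = v} = (\<lambda>w. v @ w) ` hst_leaves b (\<delta> - k)"
  proof (intro equalityI subsetI)
    fix x assume "x \<in> {x \<in> hst_leaves b \<delta>. take k x = v}"
    then have "x = v @ drop k x" "drop k x \<in> hst_leaves b (\<delta> - k)"
      using set_drop_subset[of k x] append_take_drop_id[of k x]
      by (auto simp: hst_leaves_def hst_vertices_def)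
    then show "x \<in> (\<lambda>w. v @ w) ` hst_leaves b (\<delta> - k)" by blast
  qed (use assms in \<open>auto simp: hst_leaves_def hst_vertices_def\<close>)
  then show ?thesis
    by (simp add: card_image inj_on_def card_hst_leaves)
qed

text \<open>The number of odd vertices is a sum of parity indicators, and each indicator is
  \<open>(1 - s) / 2\<close> for a product \<open>s\<close> of independent signs.\<close>

lemma expectation_card_odd_classes:
  assumes "b > 0" "k \<le> \<delta>"
  shows "measure_pmf.expectation (random_leaves b \<delta> n)
      (\<lambda>X. real (card (odd_classes (\<lambda>i. take k (X i)) {..<n}))) =
    real (b ^ k) * (1 - (1 - 2 / real (b ^ k)) ^ n) / 2"
proof -
  \<comment> \<open>The sign is -1 exactly for leaves below \<open>v\<close>, a fraction
    \<open>1 / b ^ k\<close> of all leaves; this gives the mean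
    \<open>1 - 2 / b ^ k\<close>.\<close>
  define g :: "nat list \<Rightarrow> nat list \<Rightarrow> real" where "g v x = (if take k x = v then -1 else 1)" for v x
  have sum_g: "(\<Sum>x\<in>hst_leaves b \<delta>. g v x) / real (b ^ \<delta>) = 1 - 2 / real (b ^ k)"
    if "v \<in> hst_leaves b k" for v
  proof -
    have "(\<Sum>x\<in>hst_leaves b \<delta>. g v x) = (\<Sum>x\<in>hst_leaves b \<delta>. 1 - 2 * of_bool (take k x = v))"
      by (intro sum.cong) (auto simp: g_def)
    also have "\<dots> = real (b ^ \<delta>) - 2 * real (b ^ (\<delta> - k))"
      using card_leaves_below[OF that assms(2)]
      by (simp add: sum_subtractf card_hst_leaves finite_hst_leaves Int_def flip: sum_distrib_left)
    finally show ?thesis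
      using assms power_add[of "real b" k "\<delta> - k"] by (simp add: field_simps)
  qed
  have parity: "real (card (odd_classes (\<lambda>i. take k (X i)) {..<n})) =
      (\<Sum>v\<in>hst_leaves b k. (1 - (\<Prod>i<n. g v (X i))) / 2)"
    if X: "X \<in> set_pmf (random_leaves b \<delta> n)" for X
  proof -
    have "odd_classes (\<lambda>i. take k (X i)) {..<n} \<subseteq> hst_leaves b k"
      using odd_classes_subset[of "\<lambda>i. take k (X i)" "{..<n}"]
        random_leaves_in_leaves[OF assms(1) X] take_hst_leaves[OF _ assms(2)] by fastforce
    then have "odd_classes (\<lambda>i. take k (X i)) {..<n} =
        {v \<in> hst_leaves b k. odd (card {i \<in> {..<n}. take k (X i) = v})}"
      by (auto simp: odd_classes_def)
    then have "real (card (odd_classes (\<lambda>i. take k (X i)) {..<n})) =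
        (\<Sum>v\<in>hst_leaves b k. of_bool (odd (card {i \<in> {..<n}. take k (X i) = v})))"
      by (simp add: finite_hst_leaves Int_def)
    also have "\<dots> = (\<Sum>v\<in>hst_leaves b k. (1 - (\<Prod>i<n. g v (X i))) / 2)"
    proof (intro sum.cong refl)
      fix v
      have "(\<Prod>i<n. g v (X i)) = (-1) ^ card {i \<in> {..<n}. take k (X i) = v}"
        by (simp add: g_def prod.If_cases Int_def)
      then show "of_bool (odd (card {i \<in> {..<n}. take k (X i) = v})) =
          (1 - (\<Prod>i<n. g v (X i))) / 2" by simp
    qed
    finally show ?thesis .
  qed
  have "measure_pmf.expectation (random_leaves b \<delta> n)
      (\<lambda>X. real (card (odd_classes (\<lambda>i. take k (X i)) {..<n}))) =
    measure_pmf.expectation (random_leaves b \<delta> n)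
      (\<lambda>X. \<Sum>v\<in>hst_leaves b k. (1 - (\<Prod>i<n. g v (X i))) / 2)"
    using parity by (intro integral_cong_AE) (auto simp: AE_measure_pmf_iff)
  also have "\<dots> = (\<Sum>v\<in>hst_leaves b k.
      (1 - measure_pmf.expectation (random_leaves b \<delta> n) (\<lambda>X. \<Prod>i<n. g v (X i))) / 2)"
    by (simp add: integrable_random_leaves[OF assms(1)])
  also have "\<dots> = (\<Sum>v\<in>hst_leaves b k. (1 - (1 - 2 / real (b ^ k)) ^ n) / 2)"
    by (intro sum.cong refl) (simp only: expectation_random_leaves_prod[OF assms(1)] sum_g)
  also have "\<dots> = real (b ^ k) * (1 - (1 - 2 / real (b ^ k)) ^ n) / 2"
    by (simp add: card_hst_leaves)
  finally show ?thesis .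
qed

text \<open>From \<open>1 - t \<le> exp (- t)\<close> with \<open>t = 2 / m\<close> and
  \<open>n \<ge> m\<close> the power is at most \<open>exp (- 2)\<close>, and
  \<open>exp 1 \<ge> 2\<close>. The hypothesis \<open>2 \<le> m\<close> keeps the base
  nonnegative.\<close>

lemma one_minus_two_div_power_le:
  fixes m n :: nat
  assumes "2 \<le> m" "m \<le> n"
  shows "(1 - 2 / real m) ^ n \<le> 1 / 4"
proof -
  have "(1 - 2 / real m) ^ n \<le> exp (- 2 / real m) ^ n"
    using assms exp_ge_add_one_self[of "- 2 / real m"] by (intro power_mono) (auto simp: field_simps)
  also have "\<dots> = exp (real n * (- 2 / real m))"
    by (rule exp_of_nat_mult[symmetric])
  also have "\<dots> \<le> exp (- 2)"
    using assms by (simp add: field_simps)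
  also have "\<dots> \<le> 1 / 4"
  proof -
    have "(2::real) * 2 \<le> exp 1 * exp 1"
      using exp_ge_add_one_self[of 1] by (intro mult_mono) auto
    also have "\<dots> = exp (2::real)"
      by (simp add: mult_exp_exp)
    finally show ?thesis
      using le_imp_inverse_le[of 4 "exp (2::real)"] by (simp add: exp_minus inverse_eq_divide)
  qed
  finally show ?thesis .
qed

section \<open>Bounds on the expected cost\<close>

lemma expected_matching_le:
  assumes "b > 0" "0 \<le> lam"
  shows "expected_matching b \<delta> lam n \<le> (\<Sum>k=1..\<delta>. (real b * lam) ^ k)"
  unfolding expected_matching_def
proof (rule measure_pmf.integral_le_const)
  show "AE X in measure_pmf (random_leaves b \<delta> n).
      min_matching (hst_dist b \<delta> lam) {..<n} X \<le> (\<Sum>k=1..\<delta>. (real b * lam) ^ k)"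
    using random_leaves_in_leaves[OF assms(1)] assms(2)
    by (intro AE_pmfI min_matching_le) auto
qed (rule integrable_random_leaves[OF assms(1)])

lemma expected_matching_ge:
  assumes "b \<ge> 2" "0 \<le> lam" "b ^ \<delta> \<le> n" "K \<subseteq> {1..\<delta>}"
  shows "(\<Sum>k\<in>K. lam ^ k * (3 / 8 * real b ^ k - real (n mod 2))) \<le> expected_matching b \<delta> lam n"
proof -
  have b: "b > 0" using assms(1) by simp
  then have "n > 0" using assms(3) by (metis gr0I le_zero_eq power_eq_0_iff)
  let ?O = "\<lambda>k X. real (card (odd_classes (\<lambda>i. take k (X i :: nat list)) {..<n}))"
  have "3 / 8 * real b ^ k \<le> measure_pmf.expectation (random_leaves b \<delta> n) (?O k)"
    if "k \<in> K" for k
  proof -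
    have k: "1 \<le> k" "k \<le> \<delta>" using that assms(4) by auto
    \<comment> \<open>The number \<open>b ^ k\<close> of level-\<open>k\<close> vertices lies
      between 2, since \<open>k \<ge> 1\<close>, and \<open>n\<close>, since
      \<open>n \<ge> b ^ \<delta>\<close>.\<close>
    have "2 \<le> b ^ k"
      using power_increasing[OF k(1), of b] assms(1) by simp
    moreover have "b ^ k \<le> n"
      using power_increasing[OF k(2), of b] assms(1,3) by linarith
    ultimately have "(1 - 2 / real (b ^ k)) ^ n \<le> 1 / 4"
      by (rule one_minus_two_div_power_le)
    \<comment> \<open>The constant is \<open>3 / 8 = (1 - 1 / 4) / 2\<close>.\<close>
    then have "real (b ^ k) * (3 / 8) \<le> real (b ^ k) * ((1 - (1 - 2 / real (b ^ k)) ^ n) / 2)"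
      by (intro mult_left_mono) auto
    then show ?thesis
      using expectation_card_odd_classes[OF b k(2), of n] by simp
  qed
  then have "(\<Sum>k\<in>K. lam ^ k * (3 / 8 * real b ^ k - real (n mod 2))) \<le>
      (\<Sum>k\<in>K. lam ^ k * (measure_pmf.expectation (random_leaves b \<delta> n) (?O k) - real (n mod 2)))"
    using assms(2) by (intro sum_mono mult_left_mono) auto
  also have "\<dots> = measure_pmf.expectation (random_leaves b \<delta> n)
      (\<lambda>X. \<Sum>k\<in>K. lam ^ k * (?O k X - real (n mod 2)))"
    by (simp add: integrable_random_leaves[OF b])
  also have "\<dots> \<le> expected_matching b \<delta> lam n"
    unfolding expected_matching_def
  proof (rule integral_mono_AE)
    show "AE X in measure_pmf (random_leaves b \<delta> n).
        (\<Sum>k\<in>K. lam ^ k * (?O k X - real (n mod 2))) \<le> min_matching (hst_dist b \<delta> lam) {..<n} X"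
    proof (rule AE_pmfI)
      fix X assume "X \<in> set_pmf (random_leaves b \<delta> n)"
      then show "(\<Sum>k\<in>K. lam ^ k * (?O k X - real (n mod 2))) \<le>
          min_matching (hst_dist b \<delta> lam) {..<n} X"
        using min_matching_ge[OF assms(2), of "{..<n}" X b \<delta> K]
          random_leaves_in_leaves[OF b] assms(4) \<open>n > 0\<close> by auto
    qed
  qed (rule integrable_random_leaves[OF b])+
  finally show ?thesis .
qed

theorem theorem2:
  fixes b :: nat and lam :: real
  assumes "b \<ge> 2" and "0 < lam" and "lam < 1"
  shows "(\<exists>B::real. B > 0 \<and> (\<forall>\<delta>\<ge>1. \<forall>n.
            expected_matching b \<delta> lam n \<le> B * (\<Sum>k=1..\<delta>. (real b * lam) ^ k)))
       \<and> (\<exists>A::real. A > 0 \<and> (\<forall>\<delta>\<ge>1. \<forall>n\<ge>b ^ \<delta>. \<not> (b = 2 \<and> \<delta> = 1 \<and> odd n) \<longrightarrow>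
            expected_matching b \<delta> lam n \<ge> A * (\<Sum>k=1..\<delta>. (real b * lam) ^ k)))"
proof
  show "\<exists>B::real. B > 0 \<and> (\<forall>\<delta>\<ge>1. \<forall>n.
      expected_matching b \<delta> lam n \<le> B * (\<Sum>k=1..\<delta>. (real b * lam) ^ k))"
    using expected_matching_le[of b lam] assms by (intro exI[of _ 1]) auto
next
  define x where "x = real b * lam"
  have x: "x > 0" using assms by (simp add: x_def)
  \<comment> \<open>The factor \<open>1 / 24\<close> absorbs the discarded point, and
    \<open>x / (1 + x)\<close> the possible loss of level 1.\<close>
  define A where "A = x / (24 * (1 + x))"
  have A: "A > 0" "A \<le> 1 / 24"
    using x by (auto simp: A_def field_simps)
  have "A * (\<Sum>k=1..\<delta>. x ^ k) \<le> expected_matching b \<delta> lam n"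
    if "\<delta> \<ge> 1" "n \<ge> b ^ \<delta>" "\<not> (b = 2 \<and> \<delta> = 1 \<and> odd n)" for \<delta> n
  proof -
    have ge: "1 / 24 * (\<Sum>k\<in>K. x ^ k) \<le> expected_matching b \<delta> lam n"
      if K: "K \<subseteq> {1..\<delta>}" "\<And>k. k \<in> K \<Longrightarrow> even n \<or> 3 \<le> b ^ k" for K
    proof -
      \<comment> \<open>Since \<open>3 / 8 - 1 / 24 = 1 / 3\<close>, a loss of 1 is covered as soon
        as \<open>b ^ k \<ge> 3\<close>.\<close>
      have "1 / 24 * real b ^ k \<le> 3 / 8 * real b ^ k - real (n mod 2)" if "k \<in> K" for k
      proof (cases "even n")
        case False
        then have "3 \<le> real b ^ k"
          using K(2)[OF that] by (metis of_nat_le_iff of_nat_numeral of_nat_power)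
        then show ?thesis using False by (simp add: odd_iff_mod_2_eq_one)
      qed simp
      then have "(\<Sum>k\<in>K. lam ^ k * (1 / 24 * real b ^ k)) \<le>
          (\<Sum>k\<in>K. lam ^ k * (3 / 8 * real b ^ k - real (n mod 2)))"
        using assms(2) by (intro sum_mono mult_left_mono) auto
      also have "\<dots> \<le> expected_matching b \<delta> lam n"
        using assms that \<open>n \<ge> b ^ \<delta>\<close> by (intro expected_matching_ge) auto
      finally show ?thesis
        by (simp add: x_def power_mult_distrib sum_distrib_left mult_ac)
    qed
    show ?thesis
    proof (cases "b = 2 \<and> odd n")
      case False
      have "even n \<or> 3 \<le> b ^ k" if "k \<in> {1..\<delta>}" for k
        using False assms(1) self_le_power[of b k] that by auto
      then have "1 / 24 * (\<Sum>k=1..\<delta>. x ^ k) \<le> expected_matching b \<delta> lam n"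
        by (intro ge) auto
      moreover have "A * (\<Sum>k=1..\<delta>. x ^ k) \<le> 1 / 24 * (\<Sum>k=1..\<delta>. x ^ k)"
        using A(2) x by (intro mult_right_mono sum_nonneg) auto
      ultimately show ?thesis by linarith
    next
      case True
      \<comment> \<open>Here \<open>b ^ 1 = 2\<close> is too small, so level 1 is given up;
        excluding the degenerate case guarantees that level 2 exists.\<close>
      then have "\<delta> \<ge> 2" using that by auto
      define S where "S = (\<Sum>k=2..\<delta>. x ^ k)"
      have "3 \<le> b ^ k" if "k \<in> {2..\<delta>}" for k
        using True power_increasing[of 2 k b] that by auto
      then have "1 / 24 * S \<le> expected_matching b \<delta> lam n"
        unfolding S_def by (intro ge) auto
      moreover have "(\<Sum>k=1..\<delta>. x ^ k) = x + S"
        using \<open>\<delta> \<ge> 1\<close> by (simp add: S_def sum.atLeast_Suc_atMost numeral_2_eq_2)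
      moreover have "x\<^sup>2 \<le> S"
        unfolding S_def using x \<open>\<delta> \<ge> 2\<close> by (intro member_le_sum) auto
      \<comment> \<open>After clearing denominators this reads
        \<open>x * (x + S) \<le> (1 + x) * S\<close>, that is \<open>x * x \<le> S\<close>: the
        level-2 term pays for level 1.\<close>
      then have "A * (x + S) \<le> 1 / 24 * S"
        using x by (simp add: A_def field_simps power2_eq_square)
      ultimately show ?thesis by simp
    qed
  qed
  then show "\<exists>A::real. A > 0 \<and> (\<forall>\<delta>\<ge>1. \<forall>n\<ge>b ^ \<delta>. \<not> (b = 2 \<and> \<delta> = 1 \<and> odd n) \<longrightarrow>
      expected_matching b \<delta> lam n \<ge> A * (\<Sum>k=1..\<delta>. (real b * lam) ^ k))"
    using A(1) unfolding x_def by blast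
qed

end
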